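(* Let $(A,H,\Sigma)$ be a pseudo-ASL over a field $R$, let $\preceq$ be a pseudo-ASL term order on $A$, and let $A_{lt}$ be an algebra of leading terms for $(A,H,\Sigma,\preceq)$. Then every ideal $I\subseteq A$ has a finite pseudo-ASL Gröbner basis with respect to $(A,\preceq,A_{lt})$.
   Context: All algebras are commutative, associative and unital; $R$ is a field; $\mathbb W=\{0,1,2,\dots\}$. For a finite set $H$, $\mathbb W^H$ is the monoid of monomials on $H$ (exponent vectors, written multiplicatively); a subset $\Sigma\subseteq \mathbb W^H$ is an ideal if $mm'\in\Sigma$ for all $m\in\Sigma$, $m'\in\mathbb W^H$. Pseudo-ASL: a triple $(A,H,\Sigma)$ where $A$ is an $R$-algebra, $H\subseteq A$ is a finite generating set, $\Sigma\subseteq\mathbb W^H$ is an ideal with $H\cap\Sigma=\emptyset$ (no single generator is a monomial in $\Sigma$), and the elements $\prod_{h\in H}h^{m(h)}\in A$ for $m\in\mathbb W^H\setminus\Sigma$ form an $R$-basis of $A$. These basis elements are the standard monomials; an $R$-multiple of a standard monomial is a standard term. Given a total order $\preceq$ on standard monomials, for $f\neq 0$ let $LM(f)$ be the largest standard monomial occurring (with nonzero coefficient) in $f$, $LC(f)$ its coefficient, $LT(f)=LC(f)LM(f)$; put $LT(0)=0$. Pseudo-ASL term order: a total order $\preceq$ on the standard monomials of $A$ such that (1) $1\preceq m$ for all standard monomials $m$; (2) for all standard monomials $f,g,h,k$ with $f\prec g$, $h\preceq k$, $fh\ne0$, $gk\neq 0$, one has $LM(fh)\prec LM(gk)$. Algebra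 of leading terms for $(A,H,\Sigma,\preceq)$: a pseudo-ASL $A_{lt}$ over $R$ with the same $(H,\Sigma)$ such that, with $\pi_{lt}:A\to A_{lt}$ the $R$-linear bijection that is the identity on standard monomials, for all standard monomials $m,m'\in A$ one has $\pi_{lt}(m)\pi_{lt}(m')=0$ or $\pi_{lt}(m)\pi_{lt}(m')=\pi_{lt}(LT(mm'))$. Leading ideal of an ideal $I\subseteq A$: $LI(I)=\langle \pi_{lt}(LT(f)) : f\in I\rangle\subseteq A_{lt}$. A subset $G\subseteq I$ is a pseudo-ASL Gröbner basis of $I$ with respect to $(A,\preceq,A_{lt})$ if $LI(I)=\langle\pi_{lt}(LT(g)) : g\in G\rangle$ (ideal of $A_{lt}$). *)

theory Defs
  imports
    "HOL-Algebra.Ideal"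
    "HOL-Algebra.Generated_Rings"
    "HOL-Library.Multiset"
    "Jordan_Normal_Form.Missing_VectorSpace"
begin

text \<open>
  A monomial on \<open>H\<close> is a multiset over \<open>H\<close>: \<open>count m h\<close> is the exponent of \<open>h\<close>, multiset sum is
  multiplication of monomials, \<open>{#}\<close> is \<open>1\<close> and \<open>{#h#}\<close> is the single generator \<open>h\<close>.
\<close>

definition monomials_on :: "'h set \<Rightarrow> 'h multiset set" where
  "monomials_on H = {m. set_mset m \<subseteq> H}"

definition monomial_ideal :: "'h set \<Rightarrow> 'h multiset set \<Rightarrow> bool" where
  "monomial_ideal H \<Sigma> \<longleftrightarrow>
     \<Sigma> \<subseteq> monomials_on H \<and> (\<forall>m\<in>\<Sigma>. \<forall>m'\<in>monomials_on H. m + m' \<in> \<Sigma>)"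

text \<open>
  The labelling \<open>\<iota>\<close> places the generators in the algebra. It is the identity when \<open>H \<subseteq> carrier A\<close>;
  a general \<open>\<iota>\<close> lets a second algebra carry the same pair \<open>(H, \<Sigma>)\<close>.
\<close>

definition eval_monomial ::
    "('a, 'm) monoid_scheme \<Rightarrow> 'h set \<Rightarrow> ('h \<Rightarrow> 'a) \<Rightarrow> 'h multiset \<Rightarrow> 'a" where
  "eval_monomial A H \<iota> m = (\<Otimes>\<^bsub>A\<^esub>h\<in>H. \<iota> h [^]\<^bsub>A\<^esub> count m h)"

definition standard_monomials ::
    "('a, 'm) monoid_scheme \<Rightarrow> 'h set \<Rightarrow> ('h \<Rightarrow> 'a) \<Rightarrow> 'h multiset set \<Rightarrow> 'a set" where
  "standard_monomials A H \<iota> \<Sigma> = eval_monomial A H \<iota> ` (monomials_on H - \<Sigma>)"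

text \<open>
  In \<open>generating\<close>, the subalgebra generated by \<open>H\<close> is the subring generated by \<open>H\<close> and the scalars.
  The standard monomials are a basis as a family indexed by the monomials outside \<open>\<Sigma>\<close>, whence
  \<open>inj_standard\<close>. The zero algebra is allowed (with \<open>H = {}\<close> and \<open>\<Sigma> = {{#}}\<close>).
\<close>

locale pseudo_ASL = K: field R + algebra R A
  for R :: "('r, 'k) ring_scheme" and A :: "('r, 'a, 'm) module_scheme" +
  fixes H :: "'h set" and \<iota> :: "'h \<Rightarrow> 'a" and \<Sigma> :: "'h multiset set"
  assumes finite_H: "finite H"
    and H_closed: "\<iota> ` H \<subseteq> carrier A"
    and inj_H: "inj_on \<iota> H"
    and generating:
      "generate_ring A (\<iota> ` H \<union> {c \<odot>\<^bsub>A\<^esub> \<one>\<^bsub>A\<^esub> | c. c \<in> carrier R}) = carrier A"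
    and ideal_Sigma: "monomial_ideal H \<Sigma>"
    and H_disjoint_Sigma: "\<forall>h\<in>H. {#h#} \<notin> \<Sigma>"
    and inj_standard: "inj_on (eval_monomial A H \<iota>) (monomials_on H - \<Sigma>)"
    and basis_standard: "vectorspace.basis R A (standard_monomials A H \<iota> \<Sigma>)"

text \<open>
  Below, \<open>S\<close> is a basis of \<open>A\<close> (in use: the set of standard monomials) and \<open>r\<close> a linear order on \<open>S\<close>,
  \<open>(s, t) \<in> r\<close> meaning \<open>s \<preceq> t\<close>. \<open>leading_monomial\<close> and \<open>leading_coeff\<close> are only meaningful
  for \<open>f \<noteq> 0\<close>.
\<close>

definition coordinates ::
    "('r, 'k) ring_scheme \<Rightarrow> ('r, 'a, 'm) module_scheme \<Rightarrow> 'a set \<Rightarrow> 'a \<Rightarrow> 'a \<Rightarrow> 'r" where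
  "coordinates R A S f =
     (THE c. c \<in> S \<rightarrow> carrier R \<and> (\<forall>s. s \<notin> S \<longrightarrow> c s = \<zero>\<^bsub>R\<^esub>) \<and>
             finite {s. c s \<noteq> \<zero>\<^bsub>R\<^esub>} \<and> f = module.lincomb A c {s. c s \<noteq> \<zero>\<^bsub>R\<^esub>})"

definition support ::
    "('r, 'k) ring_scheme \<Rightarrow> ('r, 'a, 'm) module_scheme \<Rightarrow> 'a set \<Rightarrow> 'a \<Rightarrow> 'a set" where
  "support R A S f = {s \<in> S. coordinates R A S f s \<noteq> \<zero>\<^bsub>R\<^esub>}"

definition leading_monomial ::
    "('r, 'k) ring_scheme \<Rightarrow> ('r, 'a, 'm) module_scheme \<Rightarrow> 'a set \<Rightarrow> 'a rel \<Rightarrow> 'a \<Rightarrow> 'a" where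
  "leading_monomial R A S r f =
     (THE s. s \<in> support R A S f \<and> (\<forall>t\<in>support R A S f. (t, s) \<in> r))"

definition leading_coeff ::
    "('r, 'k) ring_scheme \<Rightarrow> ('r, 'a, 'm) module_scheme \<Rightarrow> 'a set \<Rightarrow> 'a rel \<Rightarrow> 'a \<Rightarrow> 'r" where
  "leading_coeff R A S r f = coordinates R A S f (leading_monomial R A S r f)"

definition leading_term ::
    "('r, 'k) ring_scheme \<Rightarrow> ('r, 'a, 'm) module_scheme \<Rightarrow> 'a set \<Rightarrow> 'a rel \<Rightarrow> 'a \<Rightarrow> 'a" where
  "leading_term R A S r f =
     (if f = \<zero>\<^bsub>A\<^esub> then \<zero>\<^bsub>A\<^esub>
      else leading_coeff R A S r f \<odot>\<^bsub>A\<^esub> leading_monomial R A S r f)"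

text \<open>
  In the zero algebra \<open>S = {}\<close>, so the first condition is vacuous there; otherwise it includes
  \<open>\<one> \<in> S\<close>, which holds because \<open>\<Sigma>\<close> is a proper ideal.
\<close>

definition pseudo_ASL_term_order ::
    "('r, 'k) ring_scheme \<Rightarrow> ('r, 'a, 'm) module_scheme \<Rightarrow> 'a set \<Rightarrow> 'a rel \<Rightarrow> bool" where
  "pseudo_ASL_term_order R A S r \<longleftrightarrow>
     linear_order_on S r \<and>
     (\<forall>m\<in>S. (\<one>\<^bsub>A\<^esub>, m) \<in> r) \<and>
     (\<forall>f\<in>S. \<forall>g\<in>S. \<forall>h\<in>S. \<forall>k\<in>S.
        (f, g) \<in> r \<and> f \<noteq> g \<and> (h, k) \<in> r \<and>
        f \<otimes>\<^bsub>A\<^esub> h \<noteq> \<zero>\<^bsub>A\<^esub> \<and> g \<otimes>\<^bsub>A\<^esub> k \<noteq> \<zero>\<^bsub>A\<^esub> \<longrightarrow>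
        (leading_monomial R A S r (f \<otimes>\<^bsub>A\<^esub> h), leading_monomial R A S r (g \<otimes>\<^bsub>A\<^esub> k)) \<in> r \<and>
        leading_monomial R A S r (f \<otimes>\<^bsub>A\<^esub> h) \<noteq> leading_monomial R A S r (g \<otimes>\<^bsub>A\<^esub> k))"

text \<open>
  \<open>B\<close> is the algebra of leading terms, \<open>\<iota>\<close> its labelling of the generators \<open>H \<subseteq> carrier A\<close>.
  The map \<open>\<pi>\<close> is determined on \<open>carrier A\<close> by the second to fourth conditions; being the identity on
  standard monomials means sending each standard monomial of \<open>A\<close> to the one of \<open>B\<close> with the
  same exponents.
\<close>

definition algebra_of_leading_terms ::
    "('r, 'k) ring_scheme \<Rightarrow> ('r, 'a, 'm) module_scheme \<Rightarrow> 'a set \<Rightarrow> 'a multiset set \<Rightarrow> 'a rel \<Rightarrow>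
     ('r, 'b, 'n) module_scheme \<Rightarrow> ('a \<Rightarrow> 'b) \<Rightarrow> ('a \<Rightarrow> 'b) \<Rightarrow> bool" where
  "algebra_of_leading_terms R A H \<Sigma> r B \<iota> \<pi> \<longleftrightarrow>
     (let S = standard_monomials A H (\<lambda>h. h) \<Sigma> in
      pseudo_ASL R B H \<iota> \<Sigma> \<and>
      \<pi> \<in> module_hom R A B \<and>
      bij_betw \<pi> (carrier A) (carrier B) \<and>
      (\<forall>m \<in> monomials_on H - \<Sigma>. \<pi> (eval_monomial A H (\<lambda>h. h) m) = eval_monomial B H \<iota> m) \<and>
      (\<forall>m\<in>S. \<forall>m'\<in>S. \<pi> m \<otimes>\<^bsub>B\<^esub> \<pi> m' = \<zero>\<^bsub>B\<^esub> \<or>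
                       \<pi> m \<otimes>\<^bsub>B\<^esub> \<pi> m' = \<pi> (leading_term R A S r (m \<otimes>\<^bsub>A\<^esub> m'))))"

definition leading_ideal ::
    "('r, 'k) ring_scheme \<Rightarrow> ('r, 'a, 'm) module_scheme \<Rightarrow> 'a set \<Rightarrow> 'a rel \<Rightarrow>
     ('r, 'b, 'n) module_scheme \<Rightarrow> ('a \<Rightarrow> 'b) \<Rightarrow> 'a set \<Rightarrow> 'b set" where
  "leading_ideal R A S r B \<pi> I = Idl\<^bsub>B\<^esub> {\<pi> (leading_term R A S r f) | f. f \<in> I}"

definition pseudo_ASL_groebner_basis ::
    "('r, 'k) ring_scheme \<Rightarrow> ('r, 'a, 'm) module_scheme \<Rightarrow> 'a set \<Rightarrow> 'a rel \<Rightarrow>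
     ('r, 'b, 'n) module_scheme \<Rightarrow> ('a \<Rightarrow> 'b) \<Rightarrow> 'a set \<Rightarrow> 'a set \<Rightarrow> bool" where
  "pseudo_ASL_groebner_basis R A S r B \<pi> I G \<longleftrightarrow>
     G \<subseteq> I \<and>
     leading_ideal R A S r B \<pi> I = Idl\<^bsub>B\<^esub> {\<pi> (leading_term R A S r g) | g. g \<in> G}"

end

theory Submission
  imports Defs
begin

text \<open>
  In the algebra of leading terms everything is monomial: the leading term of a nonzero
  \<open>f \<in> I\<close> is mapped to a nonzero scalar times a monomial in the generators of \<open>B\<close>, so the
  leading ideal is generated by scalar multiples of monomials. In \<open>B\<close>, as in any commutative
  algebra, divisibility of exponent vectors implies divisibility of the monomials, and nonzero
  scalars are units. By Dickson's lemma the exponent vectors that occur as leading exponents of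
  elements of \<open>I\<close> are all divisible by one of finitely many of them. Choosing one \<open>g \<in> I\<close> for
  each of these finitely many vectors gives the basis.

  The two ingredients are thus Dickson's lemma for exponent vectors (\<open>Dickson_image\<close>), and
  the fact that the leading term of a nonzero element is a nonzero multiple of a basis
  element (\<open>leading_term_form\<close>); the latter rests on the uniqueness of coordinates with respect
  to a basis, and on finite supports having a largest element.
\<close>

section \<open>Dickson's lemma\<close>

lemma nat_seq_mono_subseq:
  fixes s :: "nat \<Rightarrow> nat"
  shows "\<exists>\<phi>::nat \<Rightarrow> nat. strict_mono \<phi> \<and> mono (\<lambda>n. s (\<phi> n))"
proof -
  obtain f :: "nat \<Rightarrow> nat" where f: "strict_mono f" "monoseq (\<lambda>n. s (f n))"
    using seq_monosub[of s] by blast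
  from f(2) consider "\<forall>m. \<forall>n\<ge>m. s (f m) \<le> s (f n)" | "\<forall>m. \<forall>n\<ge>m. s (f n) \<le> s (f m)"
    unfolding monoseq_def by blast
  then show ?thesis
  proof cases
    case 1
    with f(1) show ?thesis by (intro exI[of _ f]) (simp add: mono_def)
  next
    case 2
    \<comment> \<open>A decreasing sequence of naturals is constant from where it attains its minimum.\<close>
    obtain N where N: "\<And>n. s (f N) \<le> s (f n)"
      using ex_has_least_nat[of "\<lambda>_. True" _ "\<lambda>n. s (f n)"] by blast
    have "s (f (N + n)) = s (f N)" for n
      using N[of "N + n"] 2 by (simp add: le_antisym)
    then have "mono (\<lambda>n. s (f (N + n)))" by (simp add: mono_def)
    moreover have "strict_mono (\<lambda>n. f (N + n))"
      using f(1) by (simp add: strict_mono_def)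
    ultimately show ?thesis by blast
  qed
qed

lemma multiset_seq_mono_subseq:
  fixes e :: "nat \<Rightarrow> 'h multiset"
  assumes "finite H"
  shows "\<exists>\<phi>::nat \<Rightarrow> nat. strict_mono \<phi> \<and> (\<forall>h\<in>H. mono (\<lambda>n. count (e (\<phi> n)) h))"
  using assms
proof (induction H rule: finite_induct)
  case empty
  show ?case by (intro exI[of _ id]) (simp add: strict_mono_def)
next
  case (insert x H)
  then obtain \<phi> :: "nat \<Rightarrow> nat"
    where \<phi>: "strict_mono \<phi>" "\<forall>h\<in>H. mono (\<lambda>n. count (e (\<phi> n)) h)" by blast
  obtain \<psi> :: "nat \<Rightarrow> nat"
    where \<psi>: "strict_mono \<psi>" "mono (\<lambda>n. count (e (\<phi> (\<psi> n))) x)"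
    using nat_seq_mono_subseq[of "\<lambda>n. count (e (\<phi> n)) x"] by blast
  have "strict_mono (\<phi> \<circ> \<psi>)" by (rule strict_mono_o[OF \<phi>(1) \<psi>(1)])
  moreover have "mono (\<lambda>n. count (e ((\<phi> \<circ> \<psi>) n)) h)" if "h \<in> insert x H" for h
  proof (cases "h = x")
    case False
    with that \<phi>(2) have "mono (\<lambda>n. count (e (\<phi> n)) h)" by blast
    then show ?thesis using strict_mono_mono[OF \<psi>(1)] by (simp add: mono_def)
  qed (use \<psi>(2) in simp)
  ultimately show ?case by blast
qed

text \<open>
  The minimal elements of \<open>E\<close> form an antichain; an infinite antichain would contain a
  comparable pair, by \<open>multiset_seq_mono_subseq\<close>.
\<close>

lemma Dickson:
  assumes "finite H" and E: "E \<subseteq> monomials_on H"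
  shows "\<exists>F\<subseteq>E. finite F \<and> (\<forall>m\<in>E. \<exists>m'\<in>F. m' \<subseteq># m)"
proof -
  define F where "F = {m \<in> E. \<forall>m'\<in>E. \<not> m' \<subset># m}"
  have "finite F"
  proof (rule ccontr)
    assume "infinite F"
    then obtain e :: "nat \<Rightarrow> 'a multiset" where e: "inj e" "range e \<subseteq> F"
      using infinite_countable_subset by blast
    obtain \<phi> :: "nat \<Rightarrow> nat"
      where \<phi>: "strict_mono \<phi>" "\<forall>h\<in>H. mono (\<lambda>n. count (e (\<phi> n)) h)"
      using multiset_seq_mono_subseq[OF assms(1)] by blast
    have "e (\<phi> 0) \<subseteq># e (\<phi> 1)"
    proof (rule mset_subset_eqI)
      fix h
      have "e (\<phi> 0) \<in> monomials_on H" using e(2) E by (auto simp: F_def)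
      then have "count (e (\<phi> 0)) h = 0" if "h \<notin> H"
        using that by (auto simp: monomials_on_def not_in_iff[symmetric])
      then show "count (e (\<phi> 0)) h \<le> count (e (\<phi> 1)) h"
        using \<phi>(2) by (cases "h \<in> H") (auto simp: mono_def)
    qed
    moreover have "e (\<phi> 0) \<noteq> e (\<phi> 1)"
      using strict_monoD[OF \<phi>(1), of 0 1] by (simp add: inj_eq[OF e(1)])
    ultimately have "e (\<phi> 0) \<subset># e (\<phi> 1)" by (simp add: subset_mset.less_le)
    moreover have "e (\<phi> n) \<in> F" for n using e(2) by (rule subsetD) simp
    then have "e (\<phi> 0) \<in> E" "e (\<phi> 1) \<in> F" by (simp_all add: F_def)
    ultimately show False by (simp add: F_def)
  qed
  moreover have "\<exists>m'\<in>F. m' \<subseteq># m" if "m \<in> E" for m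
    using that
  proof (induction m rule: wfp_induct_rule[OF wfp_subset_mset])
    case (1 m)
    show ?case
    proof (cases "m \<in> F")
      case False
      with 1(2) obtain m' where m': "m' \<in> E" "m' \<subset># m" by (auto simp: F_def)
      obtain k where "k \<in> F" "k \<subseteq># m'" using 1(1)[OF m'(2,1)] by blast
      moreover have "m' \<subseteq># m" using m'(2) by (rule subset_mset.less_imp_le)
      ultimately show ?thesis using subset_mset.order_trans by blast
    qed auto
  qed
  moreover have "F \<subseteq> E" by (auto simp: F_def)
  ultimately show ?thesis by blast
qed

lemma Dickson_image:
  assumes "finite H" and "e ` X \<subseteq> monomials_on H"
  shows "\<exists>F\<subseteq>X. finite F \<and> (\<forall>x\<in>X. \<exists>y\<in>F. e y \<subseteq># e x)"
proof -
  obtain M where M: "M \<subseteq> e ` X" "finite M" "\<forall>m\<in>e ` X. \<exists>m'\<in>M. m' \<subseteq># m"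
    using Dickson[OF assms] by blast
  obtain F where "F \<subseteq> X" "finite F" "M = e ` F"
    using finite_subset_image[OF M(2,1)] by blast
  moreover from M(3) have "\<forall>x\<in>X. \<exists>y\<in>F. e y \<subseteq># e x"
    unfolding \<open>M = e ` F\<close> by simp
  ultimately show ?thesis by blast
qed

section \<open>Coordinates and leading terms\<close>

context vectorspace
begin

text \<open>
  \<open>coordinates\<close> is a definite description, so everything known about it comes from this unique
  existence. \<open>S\<close> may be infinite, so two representations are compared on the union of their finite
  supports, where their difference is a vanishing finite linear combination.
\<close>

lemma coordinates_ex1:
  assumes S: "basis S" and f: "f \<in> carrier V"
  shows "\<exists>!c. c \<in> S \<rightarrow> carrier K \<and> (\<forall>s. s \<notin> S \<longrightarrow> c s = \<zero>\<^bsub>K\<^esub>) \<and>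
           finite {s. c s \<noteq> \<zero>\<^bsub>K\<^esub>} \<and> f = lincomb c {s. c s \<noteq> \<zero>\<^bsub>K\<^esub>}"
proof (rule ex_ex1I)
  have SV: "S \<subseteq> carrier V" and indep: "lin_indpt S" and "f \<in> span S"
    using S f unfolding basis_def by auto
  then obtain a T where T: "finite T" "T \<subseteq> S" "a \<in> T \<rightarrow> carrier K" "f = lincomb a T"
    unfolding span_def by blast
  define c where "c = (\<lambda>s. if s \<in> T then a s else \<zero>\<^bsub>K\<^esub>)"
  define U where "U = {s. c s \<noteq> \<zero>\<^bsub>K\<^esub>}"
  have UT: "U \<subseteq> T" unfolding U_def c_def by auto
  have "lincomb a T = lincomb c T"
    by (rule lincomb_cong) (use T SV in \<open>auto simp: c_def\<close>)
  also have "\<dots> = lincomb c (U \<union> (T - U))"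
    using UT by (simp add: Un_absorb1)
  also have "\<dots> = lincomb c U"
    using T SV UT finite_subset[OF UT]
    by (intro lincomb_clean) (auto simp: c_def U_def)
  finally have "f = lincomb c U" using T by simp
  then show "\<exists>c. c \<in> S \<rightarrow> carrier K \<and> (\<forall>s. s \<notin> S \<longrightarrow> c s = \<zero>\<^bsub>K\<^esub>) \<and>
           finite {s. c s \<noteq> \<zero>\<^bsub>K\<^esub>} \<and> f = lincomb c {s. c s \<noteq> \<zero>\<^bsub>K\<^esub>}"
    using T finite_subset[OF UT] unfolding U_def
    by (intro exI[of _ c]) (auto simp: c_def)
next
  have SV: "S \<subseteq> carrier V" and indep: "lin_indpt S"
    using S unfolding basis_def by auto
  fix c d
  assume c: "c \<in> S \<rightarrow> carrier K \<and> (\<forall>s. s \<notin> S \<longrightarrow> c s = \<zero>\<^bsub>K\<^esub>) \<and>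
           finite {s. c s \<noteq> \<zero>\<^bsub>K\<^esub>} \<and> f = lincomb c {s. c s \<noteq> \<zero>\<^bsub>K\<^esub>}"
    and d: "d \<in> S \<rightarrow> carrier K \<and> (\<forall>s. s \<notin> S \<longrightarrow> d s = \<zero>\<^bsub>K\<^esub>) \<and>
           finite {s. d s \<noteq> \<zero>\<^bsub>K\<^esub>} \<and> f = lincomb d {s. d s \<noteq> \<zero>\<^bsub>K\<^esub>}"
  define C where "C = {s. c s \<noteq> \<zero>\<^bsub>K\<^esub>}"
  define D where "D = {s. d s \<noteq> \<zero>\<^bsub>K\<^esub>}"
  define U where "U = C \<union> D"
  have fin: "finite C" "finite D" and sub: "C \<subseteq> S" "D \<subseteq> S"
    using c d by (auto simp: C_def D_def)
  have car: "c \<in> U \<rightarrow> carrier K" "d \<in> U \<rightarrow> carrier K" and UV: "U \<subseteq> carrier V"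
    using c d sub SV by (auto simp: U_def)
  have "lincomb c (C \<union> D) = lincomb c (C \<union> (D - C))" by simp
  also have "\<dots> = lincomb c C"
    by (rule lincomb_clean) (use fin sub SV c in \<open>auto simp: C_def\<close>)
  finally have cU: "lincomb c U = f" using c by (simp add: C_def U_def)
  have "lincomb d (C \<union> D) = lincomb d (D \<union> (C - D))" by (simp add: Un_commute)
  also have "\<dots> = lincomb d D"
    by (rule lincomb_clean) (use fin sub SV d in \<open>auto simp: D_def\<close>)
  finally have dU: "lincomb d U = f" using d by (simp add: D_def U_def)
  define e where "e = (\<lambda>v. c v \<oplus>\<^bsub>K\<^esub> (\<ominus>\<^bsub>K\<^esub> \<one>\<^bsub>K\<^esub>) \<otimes>\<^bsub>K\<^esub> d v)"
  have "lincomb e U = lincomb c U \<oplus>\<^bsub>V\<^esub> lincomb (\<lambda>v. (\<ominus>\<^bsub>K\<^esub> \<one>\<^bsub>K\<^esub>) \<otimes>\<^bsub>K\<^esub> d v) U"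
    unfolding e_def
    by (rule lincomb_sum) (use fin UV car in \<open>auto simp: U_def\<close>)
  also have "lincomb (\<lambda>v. (\<ominus>\<^bsub>K\<^esub> \<one>\<^bsub>K\<^esub>) \<otimes>\<^bsub>K\<^esub> d v) U = (\<ominus>\<^bsub>K\<^esub> \<one>\<^bsub>K\<^esub>) \<odot>\<^bsub>V\<^esub> lincomb d U"
    by (rule lincomb_smult) (use UV car in auto)
  finally have e0: "lincomb e U = \<zero>\<^bsub>V\<^esub>"
    using f by (simp add: cU dU smult_minus_1 M.r_neg)
  have e: "e \<in> U \<rightarrow> carrier K" using car by (auto simp: e_def Pi_iff)
  show "c = d"
  proof
    fix v
    show "c v = d v"
    proof (cases "v \<in> U")
      case True
      have "e v = \<zero>\<^bsub>K\<^esub>"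
      proof (rule ccontr)
        assume "e v \<noteq> \<zero>\<^bsub>K\<^esub>"
        then have "lin_dep S"
          using fin sub e True e0
          by (intro lin_dep_crit[of U S e v]) (auto simp: U_def)
        then show False using indep by simp
      qed
      moreover have cd: "c v \<in> carrier K" "d v \<in> carrier K" using car True by auto
      ultimately have "c v \<ominus>\<^bsub>K\<^esub> d v = \<zero>\<^bsub>K\<^esub>"
        by (simp add: e_def R.l_minus R.minus_eq)
      with cd show ?thesis by (simp only: R.r_right_minus_eq)
    qed (auto simp: U_def C_def D_def)
  qed
qed

lemma coordinates_spec:
  assumes "basis S" and "f \<in> carrier V"
  defines "c \<equiv> coordinates K V S f"
  shows "c \<in> S \<rightarrow> carrier K" and "finite {s. c s \<noteq> \<zero>\<^bsub>K\<^esub>}"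
    and "f = lincomb c {s. c s \<noteq> \<zero>\<^bsub>K\<^esub>}" and "{s. c s \<noteq> \<zero>\<^bsub>K\<^esub>} = support K V S f"
  using theI'[OF coordinates_ex1[OF assms(1,2)]]
  unfolding c_def coordinates_def[symmetric] support_def by auto

end

text \<open>Unique existence makes \<open>leading_monomial\<close>, again a definite description, meaningful.\<close>

lemma linear_order_on_finite_has_max:
  assumes "linear_order_on S r" and "finite F" "F \<noteq> {}" "F \<subseteq> S"
  shows "\<exists>!s. s \<in> F \<and> (\<forall>t\<in>F. (t, s) \<in> r)"
proof -
  have refl: "\<And>x. x \<in> S \<Longrightarrow> (x, x) \<in> r" and "trans r" and antisym: "antisym r" and "total_on S r"
    using assms(1) by (auto simp: order_on_defs refl_on_def)
  from assms(2-4) have "\<exists>s. s \<in> F \<and> (\<forall>t\<in>F. (t, s) \<in> r)"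
  proof (induction F rule: finite_ne_induct)
    case (singleton x)
    then show ?case using refl by simp
  next
    case (insert x F)
    then obtain s where s: "s \<in> F" "\<forall>t\<in>F. (t, s) \<in> r" by auto
    then consider "(x, s) \<in> r" | "(s, x) \<in> r"
      using insert \<open>total_on S r\<close> refl unfolding total_on_def by (metis insert_subset subsetD)
    then show ?case
    proof cases
      case 2
      then have "\<forall>t\<in>insert x F. (t, x) \<in> r"
        using s insert.prems refl \<open>trans r\<close> by (auto dest: transD)
      then show ?thesis by blast
    qed (use s in auto)
  qed
  then show ?thesis using antisym by (auto dest: antisymD)
qed

text \<open>
  That \<open>c\<close> is nonzero is what matters later: it can be cancelled when one leading term is to be
  written as a multiple of another.
\<close>

lemma (in vectorspace) leading_term_form:
  assumes "basis S" and "linear_order_on S r" and f: "f \<in> carrier V" "f \<noteq> \<zero>\<^bsub>V\<^esub>"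
  shows "\<exists>c\<in>carrier K - {\<zero>\<^bsub>K\<^esub>}. \<exists>s\<in>S. leading_term K V S r f = c \<odot>\<^bsub>V\<^esub> s"
proof -
  note spec = coordinates_spec[OF assms(1) f(1)]
  have "support K V S f \<noteq> {}"
  proof
    assume "support K V S f = {}"
    with spec(3,4) have "f = lincomb (coordinates K V S f) {}" by simp
    with f(2) show False by (simp add: lincomb_def)
  qed
  moreover have "finite (support K V S f)" "support K V S f \<subseteq> S"
    using spec(2,4) by (auto simp: support_def)
  ultimately have "leading_monomial K V S r f \<in> support K V S f"
    using theI'[OF linear_order_on_finite_has_max[OF assms(2)]]
    unfolding leading_monomial_def by blast
  then show ?thesis
    using spec(1) f(2) unfolding leading_term_def leading_coeff_def support_def by auto
qed

section \<open>Monomials in a pseudo-ASL\<close>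

context pseudo_ASL
begin

lemma cring_A: "cring A" by unfold_locales

lemma vectorspace_A: "vectorspace R A" by unfold_locales

lemma eval_monomial_closed: "eval_monomial A H \<iota> m \<in> carrier A"
proof -
  have "comm_monoid A" using cring_A by (simp add: cring_def)
  then show ?thesis
    unfolding eval_monomial_def using H_closed
    by (intro comm_monoid.finprod_closed) (auto intro!: monoid.nat_pow_closed comm_monoid.axioms)
qed

lemma eval_monomial_add:
  "eval_monomial A H \<iota> (m + m') = eval_monomial A H \<iota> m \<otimes>\<^bsub>A\<^esub> eval_monomial A H \<iota> m'"
proof -
  have cm: "comm_monoid A" using cring_A by (simp add: cring_def)
  then have mon: "monoid A" by (rule comm_monoid.axioms)
  have car: "\<iota> h \<in> carrier A" if "h \<in> H" for h using H_closed that by auto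
  have "eval_monomial A H \<iota> (m + m') =
      (\<Otimes>\<^bsub>A\<^esub>h\<in>H. \<iota> h [^]\<^bsub>A\<^esub> count m h \<otimes>\<^bsub>A\<^esub> \<iota> h [^]\<^bsub>A\<^esub> count m' h)"
    unfolding eval_monomial_def
    by (rule comm_monoid.finprod_cong'[OF cm])
      (auto simp: monoid.nat_pow_mult[OF mon] car monoid.nat_pow_closed[OF mon])
  then show ?thesis
    unfolding eval_monomial_def
    by (simp add: comm_monoid.finprod_multf[OF cm] monoid.nat_pow_closed[OF mon] car)
qed

text \<open>
  Divisibility of exponents becomes divisibility of terms because \<open>c\<close> is a unit: the multiplier
  is \<open>(d / c) \<odot> x\<close>, where \<open>x\<close> is the monomial with exponents \<open>m' - m\<close>.
\<close>

lemma ideal_contains_multiple: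
  assumes J: "ideal J A" and c: "c \<in> carrier R - {\<zero>\<^bsub>R\<^esub>}" and d: "d \<in> carrier R"
    and "m \<subseteq># m'" and mem: "c \<odot>\<^bsub>A\<^esub> eval_monomial A H \<iota> m \<in> J"
  shows "d \<odot>\<^bsub>A\<^esub> eval_monomial A H \<iota> m' \<in> J"
proof -
  define x where "x = eval_monomial A H \<iota> (m' - m)"
  define y where "y = eval_monomial A H \<iota> m"
  define q where "q = d \<otimes>\<^bsub>R\<^esub> inv\<^bsub>R\<^esub> c"
  have xy: "x \<in> carrier A" "y \<in> carrier A"
    by (simp_all add: x_def y_def eval_monomial_closed)
  have cR: "c \<in> carrier R" "inv\<^bsub>R\<^esub> c \<in> carrier R" "inv\<^bsub>R\<^esub> c \<otimes>\<^bsub>R\<^esub> c = \<one>\<^bsub>R\<^esub>"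
    using c by (auto simp: K.field_Units)
  have q: "q \<in> carrier R" and qc: "q \<otimes>\<^bsub>R\<^esub> c = d"
    using cR d by (auto simp: q_def K.m_assoc)
  have "eval_monomial A H \<iota> m' = x \<otimes>\<^bsub>A\<^esub> y"
    unfolding x_def y_def eval_monomial_add[symmetric] using assms(4) by simp
  then have "d \<odot>\<^bsub>A\<^esub> eval_monomial A H \<iota> m' = q \<odot>\<^bsub>A\<^esub> (c \<odot>\<^bsub>A\<^esub> (x \<otimes>\<^bsub>A\<^esub> y))"
    using q cR xy by (simp add: qc[symmetric] smult_assoc1)
  also have "c \<odot>\<^bsub>A\<^esub> (x \<otimes>\<^bsub>A\<^esub> y) = x \<otimes>\<^bsub>A\<^esub> (c \<odot>\<^bsub>A\<^esub> y)"
    using cR xy smult_assoc2[of c y x] by (simp add: m_comm smult_closed)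
  also have "q \<odot>\<^bsub>A\<^esub> (x \<otimes>\<^bsub>A\<^esub> (c \<odot>\<^bsub>A\<^esub> y)) = (q \<odot>\<^bsub>A\<^esub> x) \<otimes>\<^bsub>A\<^esub> (c \<odot>\<^bsub>A\<^esub> y)"
    using q cR xy by (simp add: smult_assoc2)
  finally show ?thesis
    using ideal.I_l_closed[OF J mem] q xy by (simp add: y_def smult_closed)
qed

end

section \<open>Finite Groebner bases\<close>

theorem theorem4p38:
  fixes R :: "('r, 'k) ring_scheme"
    and A :: "('r, 'a, 'm) module_scheme"
    and B :: "('r, 'b, 'n) module_scheme"
    and H :: "'a set" and \<Sigma> :: "'a multiset set" and r :: "'a rel"
    and \<iota> \<pi> :: "'a \<Rightarrow> 'b" and I :: "'a set"
  defines "S \<equiv> standard_monomials A H (\<lambda>h. h) \<Sigma>"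
  assumes "pseudo_ASL R A H (\<lambda>h. h) \<Sigma>"
    and "pseudo_ASL_term_order R A S r"
    and "algebra_of_leading_terms R A H \<Sigma> r B \<iota> \<pi>"
    and "ideal I A"
  shows "\<exists>G. finite G \<and> pseudo_ASL_groebner_basis R A S r B \<pi> I G"
proof -
  interpret A: pseudo_ASL R A H "\<lambda>h. h" \<Sigma> by fact
  interpret B: pseudo_ASL R B H \<iota> \<Sigma>
    using assms(4) by (simp add: algebra_of_leading_terms_def Let_def)
  have \<pi>_hom: "\<pi> \<in> LinearCombinations.module_hom R A B"
    and \<pi>_std: "\<And>m. m \<in> monomials_on H - \<Sigma> \<Longrightarrow>
      \<pi> (eval_monomial A H (\<lambda>h. h) m) = eval_monomial B H \<iota> m"
    using assms(4) by (simp_all add: algebra_of_leading_terms_def Let_def)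
  have lin: "linear_order_on S r"
    using assms(3) by (simp add: pseudo_ASL_term_order_def)
  have ringB: "ring B" using B.cring_A by (simp add: cring_def)
  have IA: "I \<subseteq> carrier A"
    using assms(5) by (simp add: additive_subgroup.a_subset ideal.axioms(1))
  define lt where "lt f = \<pi> (leading_term R A S r f)" for f
  define X where "X = I - {\<zero>\<^bsub>A\<^esub>}"
  have "\<exists>c m. c \<in> carrier R - {\<zero>\<^bsub>R\<^esub>} \<and> m \<in> monomials_on H \<and>
      lt f = c \<odot>\<^bsub>B\<^esub> eval_monomial B H \<iota> m" if "f \<in> X" for f
  proof -
    have "f \<in> carrier A" "f \<noteq> \<zero>\<^bsub>A\<^esub>" using that IA by (auto simp: X_def)
    then obtain c s where c: "c \<in> carrier R - {\<zero>\<^bsub>R\<^esub>}" and "s \<in> S"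
      and "leading_term R A S r f = c \<odot>\<^bsub>A\<^esub> s"
      using vectorspace.leading_term_form[OF A.vectorspace_A _ lin] A.basis_standard
      unfolding S_def by meson
    moreover from \<open>s \<in> S\<close> obtain m where m: "m \<in> monomials_on H - \<Sigma>"
      and "s = eval_monomial A H (\<lambda>h. h) m"
      by (auto simp: S_def standard_monomials_def)
    ultimately have "lt f = c \<odot>\<^bsub>B\<^esub> eval_monomial B H \<iota> m"
      using \<pi>_hom \<pi>_std[OF m] A.eval_monomial_closed[of m]
      by (auto simp: lt_def module_hom_def)
    with c m show ?thesis by blast
  qed
  then obtain c e where c: "\<And>f. f \<in> X \<Longrightarrow> c f \<in> carrier R - {\<zero>\<^bsub>R\<^esub>}"
    and e: "\<And>f. f \<in> X \<Longrightarrow> e f \<in> monomials_on H"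
    and lt: "\<And>f. f \<in> X \<Longrightarrow> lt f = c f \<odot>\<^bsub>B\<^esub> eval_monomial B H \<iota> (e f)"
    by metis
  have "lt \<zero>\<^bsub>A\<^esub> = \<zero>\<^bsub>B\<^esub>"
  proof -
    have "\<pi> (\<zero>\<^bsub>R\<^esub> \<odot>\<^bsub>A\<^esub> \<zero>\<^bsub>A\<^esub>) = \<zero>\<^bsub>R\<^esub> \<odot>\<^bsub>B\<^esub> \<pi> \<zero>\<^bsub>A\<^esub>" "\<pi> \<zero>\<^bsub>A\<^esub> \<in> carrier B"
      using \<pi>_hom unfolding module_hom_def by blast+
    then show ?thesis by (simp add: lt_def leading_term_def)
  qed
  obtain G where G: "G \<subseteq> X" "finite G" "\<forall>f\<in>X. \<exists>g\<in>G. e g \<subseteq># e f"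
    using Dickson_image[OF A.finite_H, of e X] e by blast
  have closed: "lt f \<in> carrier B" if "f \<in> I" for f
    using that lt[of f] c[of f] \<open>lt \<zero>\<^bsub>A\<^esub> = \<zero>\<^bsub>B\<^esub>\<close> B.eval_monomial_closed
    by (cases "f = \<zero>\<^bsub>A\<^esub>") (auto simp: X_def intro!: B.smult_closed)
  have GI: "G \<subseteq> I" using G(1) by (auto simp: X_def)
  define J where "J = Idl\<^bsub>B\<^esub> (lt ` G)"
  have J: "ideal J B" and ltG: "lt ` G \<subseteq> J"
    unfolding J_def using closed GI
    by (auto intro!: ring.genideal_ideal[OF ringB] subsetD[OF ring.genideal_self[OF ringB]])
  have "lt f \<in> J" if "f \<in> I" for f
  proof (cases "f = \<zero>\<^bsub>A\<^esub>")
    case True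
    then show ?thesis
      using \<open>lt \<zero>\<^bsub>A\<^esub> = \<zero>\<^bsub>B\<^esub>\<close> J by (simp add: additive_subgroup.zero_closed ideal.axioms(1))
  next
    case False
    with that have f: "f \<in> X" by (simp add: X_def)
    with G(3) obtain g where g: "g \<in> G" "e g \<subseteq># e f" by blast
    then have gX: "g \<in> X" using G(1) by blast
    have "c g \<odot>\<^bsub>B\<^esub> eval_monomial B H \<iota> (e g) \<in> J"
      using ltG g(1) lt[OF gX] by auto
    then show ?thesis
      using B.ideal_contains_multiple[OF J c[OF gX] _ g(2)] c[OF f] lt[OF f] by auto
  qed
  then have "Idl\<^bsub>B\<^esub> (lt ` I) \<subseteq> J"
    by (intro ring.genideal_minimal[OF ringB J]) auto
  moreover have "J \<subseteq> Idl\<^bsub>B\<^esub> (lt ` I)"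
    unfolding J_def using closed GI
    by (intro ring.genideal_minimal[OF ringB] ring.genideal_ideal[OF ringB])
      (auto intro!: subsetD[OF ring.genideal_self[OF ringB]])
  ultimately have "Idl\<^bsub>B\<^esub> (lt ` I) = Idl\<^bsub>B\<^esub> (lt ` G)" by (simp add: J_def)
  then have "pseudo_ASL_groebner_basis R A S r B \<pi> I G"
    using GI
    by (simp add: pseudo_ASL_groebner_basis_def leading_ideal_def lt_def[symmetric] Setcompr_eq_image)
  with G(2) show ?thesis by blast
qed

end
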